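(* For any real numbers $\alpha,\beta$ with $0<\alpha<\beta<1$, there exists a market $(D,H,X,\succ_D,f_H,B_H)$ such that $\overline{w}_h\le \beta B_h$ for every hospital $h\in H$, and such that for every budget vector $B'_H=(B'_h)_{h\in H}$ with $B_h\le B'_h\le (1+\alpha)B_h$ for all $h\in H$, the market has no $B'_H$-stable matching.
   Context: A market $(D,H,X,\succ_D,f_H,B_H)$ consists of a finite set of doctors $D$, a finite set of hospitals $H$, a finite set of contracts $X\subseteq D\times H\times\mathbb{R}_{>0}$ (a contract $x=(d,h,w)$ has doctor $x_D=d$, hospital $x_H=h$ and wage $x_W=w$), for each doctor $d$ a strict preference $\succ_d$ over $X_d\cup\{\emptyset\}$ ($\emptyset$ meaning unmatched), for each hospital $h$ an additive utility $f_h$ on subsets of $X_h$ with $f_h(x)>0$ for each $x\in X_h$ and $f_h(Y)=\sum_{x\in Y}f_h(x)$, and a budget $B_h>0$; it is assumed that $0<x_W\le B_h$ for every $x\in X_h$. For $Y\subseteq X$: $Y_d=\{x\in Y: x_D=d\}$, $Y_h=\{x\in Y:x_H=h\}$, $w_h(Y)=\sum_{x\in Y_h}x_W$. Also $\overline{w}_h=\max_{x\in X_h}x_W$. A matching is a set $Y\subseteq X$ with $|Y_d|\le 1$ for all $d\in D$. Given $B'_H=(B'_h)_{h\in H}$, a matching $Y$ is $B'_H$-feasible if $w_h(Y)\le B'_h$ for all $h$. A matching $Z\subseteq X_h$ blocks $Y$ (for hospital $h$) if for every $x\in Z\setminus Y$ the doctor $x_D$ strictly prefers $x$ to her contract in $Y$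 (or to $\emptyset$ if she has none), $f_h(Z)>f_h(Y_h)$, and $w_h(Z)\le B'_h$. A matching $Y$ is $B'_H$-stable if it is $B'_H$-feasible and no hospital $h$ and set $Z\subseteq X_h$ block $Y$. *)

theory Defs
  imports Complex_Main
begin

type_synonym doctor = nat
type_synonym hospital = nat
type_synonym contract = "doctor \<times> hospital \<times> real"

definition cD :: "contract \<Rightarrow> doctor" where "cD x = fst x"
definition cH :: "contract \<Rightarrow> hospital" where "cH x = fst (snd x)"
definition cW :: "contract \<Rightarrow> real" where "cW x = snd (snd x)"

definition contracts_of_doctor :: "contract set \<Rightarrow> doctor \<Rightarrow> contract set" where
  "contracts_of_doctor Y d = {x \<in> Y. cD x = d}"
definition contracts_of_hospital :: "contract set \<Rightarrow> hospital \<Rightarrow> contract set" where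
  "contracts_of_hospital Y h = {x \<in> Y. cH x = h}"

definition wage_sum :: "contract set \<Rightarrow> hospital \<Rightarrow> real" where
  "wage_sum Y h = (\<Sum>x\<in>contracts_of_hospital Y h. cW x)"

definition util :: "(hospital \<Rightarrow> contract \<Rightarrow> real) \<Rightarrow> hospital \<Rightarrow> contract set \<Rightarrow> real" where
  "util f h Y = (\<Sum>x\<in>Y. f h x)"

definition max_wage :: "contract set \<Rightarrow> hospital \<Rightarrow> real" where
  "max_wage X h = (if contracts_of_hospital X h = {} then 0 else Max (cW ` contracts_of_hospital X h))"

(* Preferences: pref d a b means doctor d strictly prefers a to b,
   where None stands for being unmatched (\<emptyset>). *)
type_synonym prefs = "doctor \<Rightarrow> contract option \<Rightarrow> contract option \<Rightarrow> bool"

definition strict_linear_on :: "'a set \<Rightarrow> ('a \<Rightarrow> 'a \<Rightarrow> bool) \<Rightarrow> bool" where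
  "strict_linear_on A r \<longleftrightarrow>
     (\<forall>a b. r a b \<longrightarrow> a \<in> A \<and> b \<in> A) \<and>
     (\<forall>a\<in>A. \<not> r a a) \<and>
     (\<forall>a\<in>A. \<forall>b\<in>A. \<forall>c\<in>A. r a b \<longrightarrow> r b c \<longrightarrow> r a c) \<and>
     (\<forall>a\<in>A. \<forall>b\<in>A. a \<noteq> b \<longrightarrow> r a b \<or> r b a)"

definition market ::
  "doctor set \<Rightarrow> hospital set \<Rightarrow> contract set \<Rightarrow> prefs \<Rightarrow>
   (hospital \<Rightarrow> contract \<Rightarrow> real) \<Rightarrow> (hospital \<Rightarrow> real) \<Rightarrow> bool" where
  "market D H X P f B \<longleftrightarrow>
     finite D \<and> finite H \<and> finite X \<and>
     (\<forall>x\<in>X. cD x \<in> D \<and> cH x \<in> H \<and> 0 < cW x \<and> cW x \<le> B (cH x)) \<and>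
     (\<forall>d\<in>D. strict_linear_on (Some ` contracts_of_doctor X d \<union> {None}) (P d)) \<and>
     (\<forall>h\<in>H. \<forall>x\<in>contracts_of_hospital X h. f h x > 0) \<and>
     (\<forall>h\<in>H. B h > 0)"

definition is_matching :: "contract set \<Rightarrow> bool" where
  "is_matching Y \<longleftrightarrow> (\<forall>d. card (contracts_of_doctor Y d) \<le> 1 \<and> finite (contracts_of_doctor Y d))"

definition assigned :: "contract set \<Rightarrow> doctor \<Rightarrow> contract option" where
  "assigned Y d = (if contracts_of_doctor Y d = {} then None
                   else Some (THE x. x \<in> contracts_of_doctor Y d))"

definition feasible :: "hospital set \<Rightarrow> (hospital \<Rightarrow> real) \<Rightarrow> contract set \<Rightarrow> bool" where
  "feasible H B' Y \<longleftrightarrow> is_matching Y \<and> (\<forall>h\<in>H. wage_sum Y h \<le> B' h)"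

definition blocks ::
  "contract set \<Rightarrow> prefs \<Rightarrow> (hospital \<Rightarrow> contract \<Rightarrow> real) \<Rightarrow> (hospital \<Rightarrow> real) \<Rightarrow>
   hospital \<Rightarrow> contract set \<Rightarrow> contract set \<Rightarrow> bool" where
  "blocks X P f B' h Z Y \<longleftrightarrow>
     Z \<subseteq> contracts_of_hospital X h \<and> is_matching Z \<and>
     (\<forall>x\<in>Z - Y. P (cD x) (Some x) (assigned Y (cD x))) \<and>
     util f h Z > util f h (contracts_of_hospital Y h) \<and>
     wage_sum Z h \<le> B' h"

definition stable ::
  "doctor set \<Rightarrow> hospital set \<Rightarrow> contract set \<Rightarrow> prefs \<Rightarrow>
   (hospital \<Rightarrow> contract \<Rightarrow> real) \<Rightarrow> (hospital \<Rightarrow> real) \<Rightarrow> contract set \<Rightarrow> bool" where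
  "stable D H X P f B' Y \<longleftrightarrow>
     Y \<subseteq> X \<and> feasible H B' Y \<and> (\<nexists>h Z. h \<in> H \<and> blocks X P f B' h Z Y)"

end

theory Submission
  imports Defs "HOL-Library.Countable"
begin

text \<open>
  After fillers that hospital \<open>0\<close> always hires, its free budget, in units of \<open>\<eta>\<close>, is some \<open>c\<close>
  in a range whose endpoints have ratio of order \<open>N\<close>. It chooses among \<open>Solo i\<close> of size \<open>i\<close>, whose
  value is strictly convex in \<open>i\<close>, and workers \<open>Key k\<close> and \<open>Bulk k l\<close> of size 1 with values just below
  a threshold increasing in \<open>k\<close>. Hospital \<open>k \<ge> 1\<close> ties \<open>Key k\<close> to the \<open>Bulk k l\<close>: it prefers
  \<open>Key k\<close>, who leaves no room for at least \<open>2 N\<close> of them, but \<open>Key k\<close> prefers hospital \<open>0\<close> while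
  the \<open>Bulk k l\<close> prefer hospital \<open>k\<close>.
  In a stable outcome hospital \<open>0\<close> hires one \<open>Solo i\<close> and exactly those \<open>Key k\<close> whose threshold exceeds
  \<open>i\<close>. For the largest \<open>k\<close> with threshold at most \<open>i\<close>, some \<open>2 N\<close> workers \<open>Bulk k l\<close> are available;
  hiring them together with \<open>Key k\<close> and replacing \<open>Solo i\<close> by \<open>Solo (i - 2 N - 1)\<close> is profitable, since
  by convexity the average marginal value lost lies below the threshold.
  Spacing the thresholds by \<open>N + 1\<close> covers the whole range of \<open>c\<close>. The gap \<open>\<beta> - \<alpha>\<close> supplies the
  smallest free budget, and the largest stays below the size \<open>\<beta>\<close> that a single \<open>Solo\<close> may have.
\<close>

section \<open>Markets with at most one contract per doctor and hospital\<close>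

locale edge_market =
  fixes E :: "('d::countable \<times> nat) set"
    and wage :: "'d \<Rightarrow> nat \<Rightarrow> real"
    and val :: "'d \<Rightarrow> nat \<Rightarrow> real"
    and rank :: "'d \<Rightarrow> nat \<Rightarrow> nat"
  assumes finite_E: "finite E"
    and rank_pos: "(d, h) \<in> E \<Longrightarrow> 0 < rank d h"
    and rank_inj: "(d, h) \<in> E \<Longrightarrow> (d, h') \<in> E \<Longrightarrow> rank d h = rank d h' \<Longrightarrow> h = h'"
begin

definition contr :: "'d \<Rightarrow> nat \<Rightarrow> contract" where
  "contr d h = (to_nat d, h, wage d h)"

definition X :: "contract set" where
  "X = (\<lambda>(d, h). contr d h) ` E"

text \<open>Larger ranks are better. Being unmatched gets 0, so by \<open>rank_pos\<close> every
  contract of \<open>X\<close> is acceptable to its doctor.\<close>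

definition opt_rank :: "contract option \<Rightarrow> nat" where
  "opt_rank a = (case a of None \<Rightarrow> 0 | Some x \<Rightarrow> rank (from_nat (cD x)) (cH x))"

definition pref :: prefs where
  "pref n a b \<longleftrightarrow> a \<in> Some ` contracts_of_doctor X n \<union> {None} \<and>
     b \<in> Some ` contracts_of_doctor X n \<union> {None} \<and> opt_rank b < opt_rank a"

definition utility :: "hospital \<Rightarrow> contract \<Rightarrow> real" where
  "utility h x = val (from_nat (cD x)) h"

definition staff :: "contract set \<Rightarrow> nat \<Rightarrow> 'd set" where
  "staff Y h = {d. (d, h) \<in> E \<and> contr d h \<in> Y}"

lemma contr_simps [simp]:
  "cD (contr d h) = to_nat d" "cH (contr d h) = h" "cW (contr d h) = wage d h"
  by (simp_all add: contr_def cD_def cH_def cW_def)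

lemma contr_eq_iff [simp]: "contr d h = contr d' h' \<longleftrightarrow> d = d' \<and> h = h'"
  by (auto simp: contr_def)

lemma inj_contr: "inj_on (\<lambda>d. contr d h) A"
  by (auto simp: inj_on_def)

lemma opt_rank_simps [simp]: "opt_rank None = 0" "opt_rank (Some (contr d h)) = rank d h"
  by (simp_all add: opt_rank_def)

lemma utility_contr [simp]: "utility h (contr d h') = val d h"
  by (simp add: utility_def)

lemma contr_in_X [simp]: "contr d h \<in> X \<longleftrightarrow> (d, h) \<in> E"
  by (auto simp: X_def)

lemma X_E: "x \<in> X \<Longrightarrow> (\<And>d h. x = contr d h \<Longrightarrow> (d, h) \<in> E \<Longrightarrow> P) \<Longrightarrow> P"
  by (auto simp: X_def)

lemma finite_X: "finite X"
  by (simp add: X_def finite_E)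

lemma market_edge:
  assumes "\<And>d h. (d, h) \<in> E \<Longrightarrow> h \<in> H \<and> 0 < wage d h \<and> wage d h \<le> B h \<and> 0 < val d h"
    and "finite H" "\<And>h. h \<in> H \<Longrightarrow> 0 < B h"
  shows "market (to_nat ` fst ` E) H X pref utility B"
proof -
  have "strict_linear_on (Some ` contracts_of_doctor X n \<union> {None}) (pref n)" for n
  proof -
    have opt: "a = None \<or> (\<exists>d h. n = to_nat d \<and> (d, h) \<in> E \<and> a = Some (contr d h))"
      if "a \<in> Some ` contracts_of_doctor X n \<union> {None}" for a
      using that by (auto simp: contracts_of_doctor_def elim!: X_E)
    have total: "opt_rank a < opt_rank b \<or> opt_rank b < opt_rank a"
      if "a \<in> Some ` contracts_of_doctor X n \<union> {None}"
        "b \<in> Some ` contracts_of_doctor X n \<union> {None}" "a \<noteq> b" for a b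
      using opt[OF that(1)] opt[OF that(2)] that(3)
      by (elim disjE exE conjE) (auto simp: rank_pos neq_iff[symmetric] dest: rank_inj)
    show ?thesis
      unfolding strict_linear_on_def pref_def
    proof (intro conjI ballI allI impI)
      fix a b :: "contract option"
      assume "a \<in> Some ` contracts_of_doctor X n \<union> {None}"
        "b \<in> Some ` contracts_of_doctor X n \<union> {None}" "a \<noteq> b"
      then show "(a \<in> Some ` contracts_of_doctor X n \<union> {None} \<and>
          b \<in> Some ` contracts_of_doctor X n \<union> {None} \<and> opt_rank b < opt_rank a) \<or>
        (b \<in> Some ` contracts_of_doctor X n \<union> {None} \<and>
          a \<in> Some ` contracts_of_doctor X n \<union> {None} \<and> opt_rank a < opt_rank b)"
        using total by blast
    qed (blast intro: less_trans less_irrefl)+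
  qed
  then show ?thesis
    unfolding market_def using assms finite_E finite_X
    by (auto simp: contracts_of_hospital_def elim!: X_E intro: rev_image_eqI)
qed

lemma max_wage_le:
  assumes "\<And>d. (d, h) \<in> E \<Longrightarrow> wage d h \<le> b" "0 \<le> b"
  shows "max_wage X h \<le> b"
proof -
  have "finite (contracts_of_hospital X h)"
    using finite_X by (simp add: contracts_of_hospital_def)
  then show ?thesis
    using assms by (auto simp: max_wage_def contracts_of_hospital_def elim!: X_E)
qed

lemma contracts_of_hospital_staff:
  assumes "Y \<subseteq> X"
  shows "contracts_of_hospital Y h = (\<lambda>d. contr d h) ` staff Y h"
  using assms by (auto simp: contracts_of_hospital_def staff_def elim!: X_E)

text \<open>These three facts are all that is used about stability later. For the last one, a set
  \<open>R\<close> of greater value would block: its members employed elsewhere move up in rank,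
  unmatched members accept any contract, and those already at \<open>h\<close> need no
  incentive.\<close>

lemma
  assumes "stable D H X pref utility B' Y"
  shows staff_unique: "d \<in> staff Y h \<Longrightarrow> d \<in> staff Y h' \<Longrightarrow> h = h'"
    and staff_wage: "h \<in> H \<Longrightarrow> (\<Sum>d\<in>staff Y h. wage d h) \<le> B' h"
    and staff_optimal: "h \<in> H \<Longrightarrow> (\<And>d. d \<in> R \<Longrightarrow> (d, h) \<in> E) \<Longrightarrow>
      (\<And>d h'. d \<in> R \<Longrightarrow> d \<in> staff Y h' \<Longrightarrow> h' \<noteq> h \<Longrightarrow> rank d h' < rank d h) \<Longrightarrow>
      (\<Sum>d\<in>R. wage d h) \<le> B' h \<Longrightarrow> (\<Sum>d\<in>R. val d h) \<le> (\<Sum>d\<in>staff Y h. val d h)"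
proof -
  have YX: "Y \<subseteq> X" and match: "is_matching Y" and feas: "\<And>h. h \<in> H \<Longrightarrow> wage_sum Y h \<le> B' h"
    and noblock: "\<And>h Z. h \<in> H \<Longrightarrow> \<not> blocks X pref utility B' h Z Y"
    using assms by (auto simp: stable_def feasible_def)
  have same: "x = y" if "x \<in> Y" "y \<in> Y" "cD x = cD y" for x y
  proof -
    have "card (contracts_of_doctor Y (cD x)) \<le> Suc 0" "finite (contracts_of_doctor Y (cD x))"
      using match by (auto simp: is_matching_def)
    moreover have "x \<in> contracts_of_doctor Y (cD x)" "y \<in> contracts_of_doctor Y (cD x)"
      using that by (simp_all add: contracts_of_doctor_def)
    ultimately show ?thesis
      using card_le_Suc0_iff_eq by blast
  qed
  show unique: "h = h'" if "d \<in> staff Y h" "d \<in> staff Y h'" for d h h'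
    using same[of "contr d h" "contr d h'"] that by (auto simp: staff_def)
  show "(\<Sum>d\<in>staff Y h. wage d h) \<le> B' h" if "h \<in> H"
    using feas[OF that]
    by (simp add: wage_sum_def contracts_of_hospital_staff[OF YX] sum.reindex[OF inj_contr] o_def)
  show "(\<Sum>d\<in>R. val d h) \<le> (\<Sum>d\<in>staff Y h. val d h)"
    if h: "h \<in> H" and R: "\<And>d. d \<in> R \<Longrightarrow> (d, h) \<in> E"
      and up: "\<And>d h'. d \<in> R \<Longrightarrow> d \<in> staff Y h' \<Longrightarrow> h' \<noteq> h \<Longrightarrow> rank d h' < rank d h"
      and w: "(\<Sum>d\<in>R. wage d h) \<le> B' h"
  proof (rule ccontr)
    assume better: "\<not> (\<Sum>d\<in>R. val d h) \<le> (\<Sum>d\<in>staff Y h. val d h)"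
    let ?Z = "(\<lambda>d. contr d h) ` R"
    have "blocks X pref utility B' h ?Z Y"
      unfolding blocks_def
    proof (intro conjI ballI)
      show "?Z \<subseteq> contracts_of_hospital X h"
        using R by (auto simp: contracts_of_hospital_def)
      have "contracts_of_doctor ?Z n \<subseteq> {contr (from_nat n) h}" for n
        by (auto simp: contracts_of_doctor_def)
      then show "is_matching ?Z"
        unfolding is_matching_def
        by (metis card_mono card.empty card_insert_disjoint empty_iff finite.emptyI
            finite.insertI finite_subset One_nat_def)
      show "util utility h ?Z > util utility h (contracts_of_hospital Y h)"
        using better
        by (simp add: util_def contracts_of_hospital_staff[OF YX] sum.reindex[OF inj_contr] o_def)
      have "contracts_of_hospital ?Z h = ?Z"
        by (auto simp: contracts_of_hospital_def)
      then show "wage_sum ?Z h \<le> B' h"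
        using w by (simp add: wage_sum_def sum.reindex[OF inj_contr] o_def)
      fix x assume "x \<in> ?Z - Y"
      then obtain d where x: "x = contr d h" and d: "d \<in> R" and nY: "contr d h \<notin> Y" by auto
      have dE: "(d, h) \<in> E" using R d by auto
      have "assigned Y (to_nat d) = None \<or>
        (\<exists>h'. d \<in> staff Y h' \<and> assigned Y (to_nat d) = Some (contr d h'))"
      proof (cases "contracts_of_doctor Y (to_nat d) = {}")
        case False
        then obtain y where y: "y \<in> contracts_of_doctor Y (to_nat d)" by auto
        then obtain h' where h': "y = contr d h'" "(d, h') \<in> E" "y \<in> Y"
          using YX by (auto simp: contracts_of_doctor_def elim!: X_E)
        have "(THE z. z \<in> contracts_of_doctor Y (to_nat d)) = y"
          using y same by (intro the_equality) (auto simp: contracts_of_doctor_def)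
        then show ?thesis using False h' by (auto simp: assigned_def staff_def)
      qed (simp add: assigned_def)
      then show "pref (cD x) (Some x) (assigned Y (cD x))"
      proof (elim disjE exE conjE)
        assume "assigned Y (to_nat d) = None"
        then show ?thesis using dE rank_pos[OF dE]
          by (auto simp: x pref_def contracts_of_doctor_def)
      next
        fix h' assume h': "d \<in> staff Y h'" "assigned Y (to_nat d) = Some (contr d h')"
        then have "h' \<noteq> h" using nY by (auto simp: staff_def)
        then show ?thesis using dE h' up[OF d h'(1)]
          by (auto simp: x pref_def contracts_of_doctor_def staff_def)
      qed
    qed
    then show False using noblock[OF h] by blast
  qed
qed

end

section \<open>The choice problem of hospital 0\<close>

datatype worker = Filler nat | Solo nat | Key nat | Bulk nat nat

instance worker :: countable
  by countable_datatype

text \<open>The step from size \<open>i - 1\<close> to \<open>i\<close> is worth exactly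
  \<open>i\<close>, so values of unit workers can be compared directly with the size of the
  \<open>Solo\<close>.\<close>

definition triangle :: "nat \<Rightarrow> real" where
  "triangle n = real n * (real n + 1) / 2"

lemma triangle_0 [simp]: "triangle 0 = 0"
  by (simp add: triangle_def)

lemma triangle_mono: "m \<le> n \<Longrightarrow> triangle m \<le> triangle n"
  unfolding triangle_def by (intro divide_right_mono mult_mono) auto

lemma triangle_superadditive: "triangle m + triangle n \<le> triangle (m + n)"
  by (simp add: triangle_def field_simps)

text \<open>By superadditivity, several \<open>Solo\<close> workers are never worth more than one of
  their total size.\<close>

lemma sum_triangle_le: "finite I \<Longrightarrow> (\<Sum>i\<in>I. triangle i) \<le> triangle (\<Sum>i\<in>I. i)"
proof (induction I rule: finite_induct)
  case (insert i I)
  then show ?case using triangle_superadditive[of i "\<Sum>i\<in>I. i"] by simp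
qed simp

lemma triangle_diff:
  assumes "m \<le> n"
  shows "triangle n - triangle (n - m) = real m * (real n - (real m - 1) / 2)"
  using assms by (simp add: triangle_def field_simps)

text \<open>The offset makes the first threshold (\<open>k = 1\<close>) equal to
  \<open>2 * N + 1\<close>, the number of units exchanged in the decisive deviation. The last one,
  \<open>N * N + 2 * N\<close>, lies \<open>N - 1\<close> below the largest
  \<open>c\<close>.\<close>

definition threshold :: "nat \<Rightarrow> nat \<Rightarrow> nat" where
  "threshold N k = k * (N + 1) + N"

lemma threshold_ge: "N \<le> threshold N k"
  by (simp add: threshold_def)

text \<open>The fractional parts exclude ties with the integer marginal values of a
  \<open>Solo\<close>, and \<open>Key k\<close> stays strictly above
  \<open>Bulk k l\<close>.\<close>

fun unit_val :: "nat \<Rightarrow> worker \<Rightarrow> real" where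
  "unit_val N (Key k) = real (threshold N k) - 1 / 2"
| "unit_val N (Bulk k l) = real (threshold N k) - 3 / 4"
| "unit_val N _ = 0"

text \<open>\<open>W\<close> stands for the hired workers of size 1 and \<open>Av\<close> for those whom hospital \<open>0\<close> could hire; the
  remaining budget \<open>c - card W\<close> is best spent on a single \<open>Solo\<close>.\<close>

lemma no_optimal_units:
  fixes N c :: nat
  assumes N: "1 \<le> N" and c: "3 * N \<le> c" "c \<le> N * N + 3 * N - 1"
    and W: "W \<subseteq> Av" "finite W" "card W \<le> c"
    and Av: "Av \<subseteq> Key ` {1..N} \<union> (\<Union>k\<in>{1..N}. range (Bulk k))"
    and keys: "Key ` {1..N} \<subseteq> Av"
    and excl: "\<And>k l. Key k \<in> W \<Longrightarrow> Bulk k l \<notin> W"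
    and spare: "\<And>k. k \<in> {1..N} \<Longrightarrow> Key k \<notin> W \<Longrightarrow>
      \<exists>L. finite L \<and> card L = 2 * N \<and> L \<subseteq> range (Bulk k) \<and> L \<subseteq> Av"
    and opt: "\<And>W'. W' \<subseteq> Av \<Longrightarrow> finite W' \<Longrightarrow> card W' \<le> c \<Longrightarrow>
      sum (unit_val N) W' + triangle (c - card W') \<le> sum (unit_val N) W + triangle (c - card W)"
  shows False
proof -
  define i where "i = c - card W"
  \<comment> \<open>Dropping \<open>d\<close> lets the \<open>Solo\<close> grow from
    \<open>i\<close> to \<open>i + 1\<close>, a gain of \<open>i + 1\<close>.\<close>
  have remove: "real i + 1 \<le> unit_val N d" if "d \<in> W" for d
  proof -
    have "card W > 0" using that W(2) card_gt_0_iff by blast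
    then have e: "c - card (W - {d}) = i + 1"
      using that W by (simp add: i_def)
    have "W - {d} \<subseteq> Av" "card (W - {d}) \<le> c"
      using W that by (auto simp: card_Diff_singleton)
    then have "sum (unit_val N) (W - {d}) + triangle (i + 1) \<le> sum (unit_val N) W + triangle i"
      using opt[of "W - {d}"] W(2) unfolding e i_def by blast
    then show ?thesis
      using that W by (simp add: sum_diff1 triangle_def field_simps)
  qed
  \<comment> \<open>Adding \<open>d\<close> costs the last step of the \<open>Solo\<close>, worth
    \<open>i\<close>; there must be one to give up.\<close>
  have add: "unit_val N d \<le> real i" if "d \<in> Av" "d \<notin> W" "1 \<le> i" for d
  proof -
    have e: "c - card (insert d W) = i - 1" "card (insert d W) \<le> c"
      using that W by (auto simp: i_def)
    have "sum (unit_val N) (insert d W) + triangle (i - 1) \<le> sum (unit_val N) W + triangle i"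
      using opt[of "insert d W"] W that e unfolding i_def[symmetric] by auto
    then show ?thesis
      using that W triangle_diff[of 1 i] by simp
  qed
  show False
  proof (cases "i = 0")
    case True
    \<comment> \<open>Without a \<open>Solo\<close> to shrink, make room for \<open>Key k\<close> by dropping a slightly less valuable \<open>Bulk k l\<close>.\<close>
    have "\<exists>k l. Bulk k l \<in> W"
    proof (rule ccontr)
      assume "\<nexists>k l. Bulk k l \<in> W"
      then have "W \<subseteq> Key ` {1..N}" using W(1) Av by blast
      then have "card W \<le> card (Key ` {1..N})" by (intro card_mono) auto
      also have "\<dots> \<le> N" using card_image_le[of "{1..N}" Key] by simp
      finally show False using True c N by (simp add: i_def)
    qed
    then obtain k l where kl: "Bulk k l \<in> W" by blast
    have k: "Key k \<notin> W" "Key k \<in> Av"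
      using excl kl W(1) Av keys by blast+
    let ?W = "insert (Key k) (W - {Bulk k l})"
    have "card W > 0" using kl W(2) card_gt_0_iff by blast
    then have e: "card ?W = card W" using kl k W by simp
    have "sum (unit_val N) ?W \<le> sum (unit_val N) W"
      using opt[of ?W] W k e by auto
    then show False
      using kl k W by (simp add: sum_diff1)
  next
    case False
    \<comment> \<open>A hired \<open>Bulk k l\<close> puts \<open>i + 1\<close> below the threshold
      of \<open>k\<close>, whereas the absence of \<open>Key k\<close> puts the threshold at or
      below \<open>i\<close>.\<close>
    have noBulk: "Bulk k l \<notin> W" for k l
    proof
      assume kl: "Bulk k l \<in> W"
      then have "Key k \<notin> W" "Key k \<in> Av"
        using excl W(1) Av keys by blast+
      then show False using remove[OF kl] add[of "Key k"] False by auto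
    qed
    then have WK: "W \<subseteq> Key ` {1..N}" using W(1) Av by blast
    let ?J = "{j \<in> {1..N}. Key j \<notin> W}"
    show False
    proof (cases "?J = {}")
      case True
      then have "W = Key ` {1..N}" using WK by auto
      moreover have "inj_on Key {1..N}" by (simp add: inj_on_def)
      ultimately have "card W = N" by (simp add: card_image)
      \<comment> \<open>\<open>Key 1\<close> is worth only \<open>2 * N + 1 / 2\<close>, less than
        the step to \<open>i + 1\<close> that dropping it would allow.\<close>
      then have "2 * N \<le> i" using c by (simp add: i_def)
      moreover have "Key 1 \<in> W" using True N by auto
      ultimately show False using remove[of "Key 1"] by (simp add: threshold_def)
    next
      case nonempty: False
      define k where "k = Max ?J"
      have k: "k \<in> {1..N}" "Key k \<notin> W"
        using Max_in[OF _ nonempty] by (auto simp: k_def)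
      have last: "Key j \<in> W" if "k < j" "j \<le> N" for j
      proof (rule ccontr)
        assume "Key j \<notin> W"
        then have "j \<le> k" unfolding k_def using that by (intro Max_ge) auto
        then show False using that by simp
      qed
      have lower: "threshold N k \<le> i"
      proof -
        have "Key k \<in> Av" using k keys by blast
        then have "real (threshold N k) < real (i + 1)"
          using add[of "Key k"] k False by simp
        then show ?thesis unfolding of_nat_less_iff by simp
      qed
      \<comment> \<open>For \<open>k = N\<close> this is the upper bound on \<open>c\<close>;
        otherwise \<open>Key (k + 1)\<close> is hired, and its threshold is \<open>N + 1\<close>
        higher.\<close>
      have upper: "i \<le> threshold N k + N - 1"
      proof (cases "k = N")
        case True
        then show ?thesis using c by (simp add: i_def threshold_def)
      next
        case False
        then have "Key (k + 1) \<in> W" using k last by auto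
        then have "real (i + 1) < real (threshold N (k + 1))"
          using remove[of "Key (k + 1)"] by simp
        then show ?thesis unfolding of_nat_less_iff by (simp add: threshold_def)
      qed
      obtain L where L: "finite L" "card L = 2 * N" "L \<subseteq> range (Bulk k)" "L \<subseteq> Av"
        using spare k by blast
      let ?W = "insert (Key k) (W \<union> L)"
      have dis: "W \<inter> L = {}" "Key k \<notin> W \<union> L" using L(3) noBulk k by auto
      have "1 * (N + 1) + N \<le> threshold N k"
        unfolding threshold_def using k by (intro add_le_mono1 mult_le_mono1) simp
      then have i: "2 * N + 1 \<le> i"
        using lower by simp
      have card: "card ?W = card W + (2 * N + 1)"
        using dis W L by (simp add: card_Un_disjoint)
      have e: "c - card ?W = i - (2 * N + 1)" "card ?W \<le> c"
        using i unfolding card i_def by auto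
      have "sum (unit_val N) L = (\<Sum>d\<in>L. real (threshold N k) - 3 / 4)"
        using L(3) by (intro sum.cong) auto
      then have "sum (unit_val N) ?W = sum (unit_val N) W + (real (threshold N k) - 1 / 2)
          + 2 * real N * (real (threshold N k) - 3 / 4)"
        using dis W L by (simp add: sum.union_disjoint)
      moreover have "sum (unit_val N) ?W + triangle (i - (2 * N + 1)) \<le> sum (unit_val N) W + triangle i"
      proof -
        have "Key k \<in> Av" using k keys by blast
        then show ?thesis using opt[of ?W] e W L unfolding i_def[symmetric] by auto
      qed
      ultimately have "(real (threshold N k) - 1 / 2) + 2 * real N * (real (threshold N k) - 3 / 4)
          \<le> (2 * real N + 1) * (real i - real N)"
        using triangle_diff[OF i] by (simp add: algebra_simps)
      \<comment> \<open>The \<open>2 * N + 1\<close> steps given up have average value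
        \<open>i - N\<close>, at most the threshold minus 1, while every worker gained is worth at
        least the threshold minus 3/4.\<close>
      also have "\<dots> \<le> (2 * real N + 1) * (real (threshold N k) - 1)"
      proof (intro mult_left_mono)
        show "real i - real N \<le> real (threshold N k) - 1"
          using upper N by linarith
      qed simp
      finally show False using N by (simp add: algebra_simps)
    qed
  qed
qed

section \<open>The unstable market\<close>

text \<open>\<open>N_large\<close> serves two ends: the smallest free budget of hospital
  \<open>0\<close> holds \<open>3 * N\<close> units, and a hospital employing \<open>Key k\<close>
  leaves out at least \<open>2 * N\<close> of the \<open>Bulk k l\<close>.\<close>

locale budget_window =
  fixes \<alpha> \<beta> :: real and N :: nat
  assumes \<alpha>_pos: "0 < \<alpha>" and \<alpha>_less: "\<alpha> < \<beta>" and \<beta>_less: "\<beta> < 1"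
    and N_large: "6 \<le> real N * (\<beta> - \<alpha>)"
begin

text \<open>The size of the largest \<open>Solo\<close>; it is at least the largest possible \<open>c\<close>.\<close>

definition "K = N * N + 3 * N - 1"

text \<open>Scaled so that \<open>K + 1\<close> units cost exactly \<beta>, which exceeds the
  largest free budget \<open>r + \<alpha>\<close>.\<close>

definition \<eta> :: real where "\<eta> = \<beta> / (real K + 1)"

text \<open>The free budget of hospital \<open>0\<close> when its budget is exactly 1.\<close>

definition r :: real where "r = (\<beta> - \<alpha>) / 2"

definition fillers :: "worker set" where "fillers = Filler ` {..<N}"

definition solos :: "worker set" where "solos = Solo ` {1..K}"

definition units :: "worker set" where
  "units = Key ` {1..N} \<union> (\<lambda>(k, l). Bulk k l) ` ({1..N} \<times> {..<N * N})"

fun home :: "worker \<Rightarrow> nat" where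
  "home (Key k) = k" | "home (Bulk k l) = k" | "home _ = 0"

definition edges :: "(worker \<times> nat) set" where
  "edges = (fillers \<union> solos \<union> units) \<times> {0} \<union> (\<lambda>d. (d, home d)) ` units"

text \<open>The amount \<open>1 - r\<close> is split among \<open>N\<close> fillers to keep each
  wage at most \<beta>. At hospital \<open>k \<ge> 1\<close>, the \<open>N * N\<close> workers
  \<open>Bulk k l\<close> together cost exactly 1, the smallest budget.\<close>

fun wage :: "worker \<Rightarrow> nat \<Rightarrow> real" where
  "wage (Filler i) h = (1 - r) / real N"
| "wage (Solo i) h = real i * \<eta>"
| "wage (Key k) h = (if h = 0 then \<eta> else \<beta>)"
| "wage (Bulk k l) h = (if h = 0 then \<eta> else 1 / real (N * N))"

fun base_val :: "worker \<Rightarrow> real" where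
  "base_val (Solo i) = triangle i" | "base_val d = unit_val N d"

text \<open>One filler outweighs all other workers of hospital \<open>0\<close> together.\<close>

definition filler_val :: real where
  "filler_val = 1 + (\<Sum>d\<in>solos \<union> units. base_val d)"

text \<open>At its home hospital, \<open>Key k\<close> outweighs all \<open>N * N\<close> workers
  \<open>Bulk k l\<close> together.\<close>

fun val :: "worker \<Rightarrow> nat \<Rightarrow> real" where
  "val (Filler i) h = filler_val"
| "val (Solo i) h = triangle i"
| "val (Key k) h = (if h = 0 then unit_val N (Key k) else real (N * N) + 1)"
| "val (Bulk k l) h = (if h = 0 then unit_val N (Bulk k l) else 1)"

fun rank :: "worker \<Rightarrow> nat \<Rightarrow> nat" where
  "rank (Key k) h = (if h = 0 then 2 else 1)"
| "rank (Bulk k l) h = (if h = 0 then 1 else 2)"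
| "rank _ h = 1"

lemma N_pos: "1 \<le> N"
  using N_large by (cases N) auto

lemma \<eta>_pos: "0 < \<eta>"
  using \<alpha>_pos \<alpha>_less by (simp add: \<eta>_def add_nonneg_pos)

lemma real_K: "real K + 1 = real N * (real N + 3)"
proof -
  have "K + 1 = N * N + 3 * N" using N_pos by (simp add: K_def)
  then have "real (K + 1) = real (N * N + 3 * N)" by simp
  then show ?thesis by (simp add: algebra_simps)
qed

lemma solo_wage_le: "i \<le> K \<Longrightarrow> real i * \<eta> \<le> \<beta>"
proof -
  assume "i \<le> K"
  then have "real i * \<eta> \<le> (real K + 1) * \<eta>"
    using \<eta>_pos by (intro mult_right_mono) auto
  then show ?thesis by (simp add: \<eta>_def add_nonneg_pos)
qed

lemma N_\<beta>: "1 \<le> real N * \<beta>"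
proof -
  have "real N * (\<beta> - \<alpha>) \<le> real N * \<beta>" using \<alpha>_pos by (intro mult_left_mono) auto
  then show ?thesis using N_large by linarith
qed

lemma r_bounds: "0 < r" "r < 1"
  using \<alpha>_pos \<alpha>_less \<beta>_less by (auto simp: r_def)

lemma filler_wage: "0 < (1 - r) / real N" "(1 - r) / real N \<le> \<beta>"
proof -
  have "1 - r \<le> \<beta> * real N" using N_\<beta> r_bounds by (simp add: mult.commute)
  then show "0 < (1 - r) / real N" "(1 - r) / real N \<le> \<beta>"
    using N_pos r_bounds by (simp_all add: field_simps)
qed

lemma bulk_wage: "0 < 1 / real (N * N)" "1 / real (N * N) \<le> \<beta>"
proof -
  have "1 * 1 \<le> real N * (real N * \<beta>)"
    using N_\<beta> N_pos by (intro mult_mono) auto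
  then show "0 < 1 / real (N * N)" "1 / real (N * N) \<le> \<beta>"
    using N_pos by (simp_all add: field_simps)
qed

lemma unit_val_pos: "0 < unit_val N (Key k)" "0 < unit_val N (Bulk k l)"
proof -
  have "1 \<le> real (threshold N k)"
    using threshold_ge[of N k] N_pos by linarith
  then show "0 < unit_val N (Key k)" "0 < unit_val N (Bulk k l)" by simp_all
qed

lemma base_val_pos: "d \<in> solos \<union> units \<Longrightarrow> 0 < base_val d"
  using unit_val_pos
  by (cases d) (auto simp: solos_def units_def triangle_def simp del: unit_val.simps)

lemma filler_val_pos: "0 < filler_val"
  unfolding filler_val_def by (intro add_pos_nonneg sum_nonneg less_imp_le[OF base_val_pos]) auto

lemma finite_sets: "finite fillers" "finite solos" "finite units"
  by (simp_all add: fillers_def solos_def units_def)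

lemma edges_iff [simp]:
  "(Filler i, h) \<in> edges \<longleftrightarrow> i < N \<and> h = 0"
  "(Solo i, h) \<in> edges \<longleftrightarrow> i \<in> {1..K} \<and> h = 0"
  "(Key k, h) \<in> edges \<longleftrightarrow> k \<in> {1..N} \<and> (h = 0 \<or> h = k)"
  "(Bulk k l, h) \<in> edges \<longleftrightarrow> k \<in> {1..N} \<and> l < N * N \<and> (h = 0 \<or> h = k)"
  unfolding edges_def fillers_def solos_def units_def by (force+)

sublocale edge_market edges wage val rank
proof
  show "finite edges" by (simp add: edges_def finite_sets)
  show "0 < rank d h" for d h by (cases d) auto
  show "h = h'" if "(d, h) \<in> edges" "(d, h') \<in> edges" "rank d h = rank d h'" for d h h'
    using that by (cases d; cases "h = 0"; cases "h' = 0") simp_all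
qed

lemma edges_bounds:
  assumes "(d, h) \<in> edges"
  shows "h \<in> {0..N} \<and> 0 < wage d h \<and> wage d h \<le> \<beta> \<and> 0 < val d h"
proof -
  have "\<eta> \<le> \<beta>" using solo_wage_le[of 1] N_pos by (simp add: K_def)
  moreover have "0 < \<beta>" using \<alpha>_pos \<alpha>_less by simp
  moreover have "0 < real (N * N) + 1" by (simp add: add_nonneg_pos)
  ultimately show ?thesis
    using assms \<eta>_pos solo_wage_le filler_wage bulk_wage filler_val_pos unit_val_pos
    by (cases d) (auto simp: triangle_def simp del: unit_val.simps of_nat_mult)
qed

lemma is_market: "market (to_nat ` fst ` edges) {0..N} X pref utility (\<lambda>_. 1)"
  using edges_bounds \<beta>_less by (intro market_edge) (fastforce+)

fun size0 :: "worker \<Rightarrow> nat" where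
  "size0 (Filler i) = 0" | "size0 (Solo i) = i" | "size0 _ = 1"

lemma wage0: "d \<notin> fillers \<Longrightarrow> (d, 0) \<in> edges \<Longrightarrow> wage d 0 = real (size0 d) * \<eta>"
  by (cases d) (auto simp: fillers_def)

lemma val0: "d \<notin> fillers \<Longrightarrow> (d, 0) \<in> edges \<Longrightarrow> val d 0 = base_val d"
  by (cases d) (auto simp: fillers_def)

lemma fillers_simps: "d \<in> fillers \<Longrightarrow> (d, h) \<in> edges \<longleftrightarrow> h = 0"
  "d \<in> fillers \<Longrightarrow> wage d h = (1 - r) / real N" "d \<in> fillers \<Longrightarrow> val d h = filler_val"
  by (auto simp: fillers_def)

lemma card_fillers: "card fillers = N"
  by (simp add: fillers_def card_image inj_on_def)

lemma sum_filler_wages: "(\<Sum>d\<in>fillers. wage d 0) = 1 - r"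
  using N_pos by (simp add: fillers_simps card_fillers)

lemma edges0: "{d. (d, 0) \<in> edges} = fillers \<union> (solos \<union> units)"
  unfolding edges_def units_def by auto

lemma disjoint_sets: "fillers \<inter> (solos \<union> units) = {}" "solos \<inter> units = {}"
  by (auto simp: fillers_def solos_def units_def)

end

section \<open>Hospitals \<open>k \<ge> 1\<close> in a supposed stable outcome\<close>

locale stable_outcome = budget_window +
  fixes B' :: "nat \<Rightarrow> real" and Y :: "contract set"
  assumes budget: "\<And>h. h \<in> {0..N} \<Longrightarrow> 1 \<le> B' h \<and> B' h \<le> 1 + \<alpha>"
    and stable: "stable (to_nat ` fst ` edges) {0..N} X pref utility B' Y"
begin

abbreviation "S \<equiv> staff Y"

lemmas unique = staff_unique[OF stable]
lemmas wages = staff_wage[OF stable]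
lemmas optimal = staff_optimal[OF stable]

lemma S_edges: "d \<in> S h \<Longrightarrow> (d, h) \<in> edges"
  by (simp add: staff_def)

lemma S_home:
  assumes "k \<in> {1..N}"
  shows "S k \<subseteq> insert (Key k) (Bulk k ` {..<N * N})"
proof
  fix d assume "d \<in> S k"
  then have "(d, k) \<in> edges" by (rule S_edges)
  then show "d \<in> insert (Key k) (Bulk k ` {..<N * N})" using assms by (cases d) auto
qed

lemma sum_bulk: "B \<subseteq> Bulk k ` {..<N * N} \<Longrightarrow> k \<noteq> 0 \<Longrightarrow> (\<Sum>d\<in>B. val d k) = real (card B)"
  by (subst sum.cong[OF refl, of _ _ "\<lambda>_. 1"]) auto

lemma sum_bulk_wage:
  "B \<subseteq> Bulk k ` {..<N * N} \<Longrightarrow> k \<noteq> 0 \<Longrightarrow> (\<Sum>d\<in>B. wage d k) = real (card B) / real (N * N)"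
  by (subst sum.cong[OF refl, of _ _ "\<lambda>_. 1 / real (N * N)"]) auto

lemma card_bulk: "card (Bulk k ` A) = card A"
  by (simp add: card_image inj_on_def)

text \<open>With \<open>Key k\<close> away, hospital \<open>k\<close> can afford all its
  \<open>Bulk\<close> workers, and they prefer it to hospital \<open>0\<close>. Its value then
  counts heads, so optimality makes it hire all of them.\<close>

lemma no_bulk_if_key:
  assumes "Key k \<in> S 0"
  shows "Bulk k l \<notin> S 0"
proof
  assume b: "Bulk k l \<in> S 0"
  have k: "k \<in> {1..N}" using S_edges[OF assms] by simp
  have l: "l < N * N" using S_edges[OF b] by simp
  let ?B = "Bulk k ` {..<N * N}"
  have "Key k \<notin> S k" using unique[OF assms] k by auto
  then have sub: "S k \<subseteq> ?B" using S_home[OF k] by auto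
  have "(\<Sum>d\<in>?B. val d k) \<le> (\<Sum>d\<in>S k. val d k)"
  proof (rule optimal)
    show "(\<Sum>d\<in>?B. wage d k) \<le> B' k"
      using k budget[of k] N_pos by (subst sum_bulk_wage) (auto simp: card_bulk)
    show "rank d h' < rank d k" if "d \<in> ?B" "d \<in> S h'" "h' \<noteq> k" for d h'
      using that k S_edges[OF that(2)] by auto
  qed (use k in auto)
  then have "card ?B \<le> card (S k)"
    using k sub by (simp add: sum_bulk)
  then have "S k = ?B" using card_seteq[OF _ sub] by simp
  then show False using unique[OF b, of k] l k by auto
qed

text \<open>If hospital \<open>0\<close> does not hire \<open>Key k\<close>, hospital
  \<open>k\<close> does. After the wage \<beta> at most \<open>1 + \<alpha> - \<beta>\<close>
  remains for \<open>Bulk\<close> workers, so at least \<open>(\<beta> - \<alpha>) * N * N\<close>,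
  hence at least \<open>6 * N\<close>, of them are left out.\<close>

lemma spare_bulk:
  assumes k: "k \<in> {1..N}" and nk: "Key k \<notin> S 0"
  shows "\<exists>L. finite L \<and> card L = 2 * N \<and> L \<subseteq> Bulk k ` {..<N * N} - S k"
proof -
  let ?B = "Bulk k ` {..<N * N}"
  have key: "Key k \<in> S k"
  proof (rule ccontr)
    assume "Key k \<notin> S k"
    then have sub: "S k \<subseteq> ?B" using S_home[OF k] by auto
    have "(\<Sum>d\<in>{Key k}. val d k) \<le> (\<Sum>d\<in>S k. val d k)"
    proof (rule optimal)
      show "rank d h' < rank d k" if "d \<in> {Key k}" "d \<in> S h'" "h' \<noteq> k" for d h'
        using that nk S_edges[OF that(2)] by auto
    qed (use k budget[of k] \<beta>_less in auto)
    also have "\<dots> = real (card (S k))"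
      using sub k by (simp add: sum_bulk)
    also have "\<dots> \<le> real (card ?B)"
      using card_mono[OF _ sub] by simp
    finally show False using k by (simp add: card_bulk)
  qed
  have "S k = insert (Key k) (S k \<inter> ?B)" using S_home[OF k] key by auto
  then have "(\<Sum>d\<in>S k. wage d k) = (\<Sum>d\<in>insert (Key k) (S k \<inter> ?B). wage d k)" by simp
  also have "\<dots> = \<beta> + real (card (S k \<inter> ?B)) / real (N * N)"
    using k by (subst sum.insert) (auto simp: sum_bulk_wage)
  finally have "\<beta> + real (card (S k \<inter> ?B)) / real (N * N) \<le> 1 + \<alpha>"
    using wages[of k] budget[of k] k by fastforce
  then have "real (card (S k \<inter> ?B)) \<le> (1 + \<alpha> - \<beta>) * real (N * N)"
    using N_pos by (simp add: field_simps)
  moreover have "card (S k \<inter> ?B) + card (?B - S k) = N * N"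
    using card_Int_Diff[of ?B "S k"] by (simp add: card_bulk Int_commute)
  then have "real (card (S k \<inter> ?B)) + real (card (?B - S k)) = real (N * N)"
    by (metis of_nat_add)
  moreover have "real N * 6 \<le> real N * (real N * (\<beta> - \<alpha>))"
    using N_large by (intro mult_left_mono) auto
  ultimately have "real (2 * N) \<le> real (card (?B - S k))"
    by (simp add: algebra_simps)
  then have "2 * N \<le> card (?B - S k)" by simp
  then show ?thesis
    using obtain_subset_with_card_n by metis
qed

section \<open>The free budget of hospital \<open>0\<close> in units of \<eta>\<close>

definition cap :: nat where
  "cap = nat \<lfloor>(B' 0 - (1 - r)) / \<eta>\<rfloor>"

lemma le_cap_iff: "n \<le> cap \<longleftrightarrow> (1 - r) + real n * \<eta> \<le> B' 0"
proof -
  have "0 \<le> B' 0 - (1 - r)" using budget[of 0] r_bounds by auto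
  then have "0 \<le> (B' 0 - (1 - r)) / \<eta>" using \<eta>_pos by simp
  then have "n \<le> cap \<longleftrightarrow> real n \<le> (B' 0 - (1 - r)) / \<eta>"
    unfolding cap_def by (simp add: nat_le_iff le_nat_iff le_floor_iff)
  also have "\<dots> \<longleftrightarrow> real n * \<eta> \<le> B' 0 - (1 - r)"
    using \<eta>_pos by (simp add: pos_le_divide_eq)
  finally show ?thesis by auto
qed

text \<open>The budget 1 already leaves \<open>r\<close>, which covers \<open>3 * N\<close> units by
  \<open>N_large\<close>; the budget \<open>1 + \<alpha>\<close> leaves
  \<open>r + \<alpha> < \<beta>\<close>, short of \<open>K + 1\<close> units.\<close>

lemma cap_bounds: "3 * N \<le> cap" "cap \<le> K"
proof -
  have pos: "0 < real N" "0 < real N + 3" using N_pos by auto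
  have \<eta>: "\<eta> = \<beta> / (real N * (real N + 3))" by (simp add: \<eta>_def real_K)
  have "6 * \<beta> \<le> 6" "0 \<le> 3 * (\<beta> - \<alpha>)" using \<beta>_less \<alpha>_less by auto
  then have "6 * \<beta> \<le> real N * (\<beta> - \<alpha>) + 3 * (\<beta> - \<alpha>)" using N_large by simp
  then have "6 * \<beta> \<le> (real N + 3) * (\<beta> - \<alpha>)" by (simp only: distrib_right)
  then have "3 * \<beta> / (real N + 3) \<le> r"
    using pos unfolding r_def by (simp add: field_simps)
  moreover have "real (3 * N) * \<eta> = 3 * \<beta> / (real N + 3)"
    using pos by (simp add: \<eta>)
  ultimately show "3 * N \<le> cap"
    using budget[of 0] unfolding le_cap_iff by auto
  have "(real K + 1) * \<eta> = \<beta>"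
    unfolding \<eta>_def by (simp add: add_nonneg_pos less_imp_neq[symmetric])
  then have "real (K + 1) * \<eta> = \<beta>" by (simp only: of_nat_add of_nat_1)
  moreover have "r + \<alpha> < \<beta>" using \<alpha>_less by (simp add: r_def field_simps)
  ultimately have "\<not> K + 1 \<le> cap"
    using budget[of 0] unfolding le_cap_iff by auto
  then show "cap \<le> K" by simp
qed

text \<open>The set of all fillers is affordable and willing, and it beats any staff that lacks one
  of them, by the choice of \<open>filler_val\<close>.\<close>

lemma fillers_in: "fillers \<subseteq> S 0"
proof (rule ccontr)
  assume "\<not> fillers \<subseteq> S 0"
  then obtain d where d: "d \<in> fillers" "d \<notin> S 0" by blast
  have "(\<Sum>d\<in>fillers. val d 0) \<le> (\<Sum>d\<in>S 0. val d 0)"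
  proof (rule optimal)
    show "(\<Sum>d\<in>fillers. wage d 0) \<le> B' 0"
      using budget[of 0] r_bounds unfolding sum_filler_wages by auto
    show "rank d h' < rank d 0" if "d \<in> fillers" "d \<in> S h'" "h' \<noteq> 0" for d h'
      using that S_edges[OF that(2)] by (auto simp: fillers_simps)
  qed (auto simp: fillers_simps)
  also have "\<dots> \<le> (\<Sum>d\<in>(fillers - {d}) \<union> (solos \<union> units). val d 0)"
  proof (rule sum_mono2)
    show "S 0 \<subseteq> (fillers - {d}) \<union> (solos \<union> units)"
      using d edges0 S_edges by blast
    show "0 \<le> val b 0" if "b \<in> (fillers - {d}) \<union> (solos \<union> units) - S 0" for b
    proof -
      have "(b, 0) \<in> edges" using that edges0 by blast
      then show ?thesis using edges_bounds by (auto intro: less_imp_le)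
    qed
  qed (simp add: finite_sets)
  also have "\<dots> = (\<Sum>d\<in>fillers - {d}. val d 0) + (\<Sum>d\<in>solos \<union> units. val d 0)"
    using disjoint_sets by (intro sum.union_disjoint) (auto simp: finite_sets)
  also have "(\<Sum>d\<in>solos \<union> units. val d 0) = (\<Sum>d\<in>solos \<union> units. base_val d)"
    using disjoint_sets edges0 by (intro sum.cong refl val0) auto
  also have "\<dots> < filler_val" by (simp add: filler_val_def)
  finally show False
    using sum.remove[OF finite_sets(1) d(1), of "\<lambda>d. val d 0"] fillers_simps(3)[OF d(1), of 0]
    by linarith
qed

section \<open>Reduction to the choice problem of hospital \<open>0\<close>\<close>

abbreviation "G \<equiv> S 0 - fillers"

lemma G_subset: "G \<subseteq> solos \<union> units"
  using edges0 S_edges by blast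

lemma S0_eq: "S 0 = fillers \<union> G"
  using fillers_in by blast

lemma sum_wage0:
  assumes "R \<subseteq> solos \<union> units"
  shows "(\<Sum>d\<in>fillers \<union> R. wage d 0) = (1 - r) + real (\<Sum>d\<in>R. size0 d) * \<eta>"
proof -
  have "finite R" using assms finite_sets finite_subset by blast
  then have "(\<Sum>d\<in>fillers \<union> R. wage d 0) = (\<Sum>d\<in>fillers. wage d 0) + (\<Sum>d\<in>R. wage d 0)"
    using assms disjoint_sets by (intro sum.union_disjoint) (auto simp: finite_sets)
  also have "(\<Sum>d\<in>R. wage d 0) = (\<Sum>d\<in>R. real (size0 d) * \<eta>)"
    using assms disjoint_sets edges0 by (intro sum.cong refl wage0) blast+
  finally show ?thesis by (simp only: sum_filler_wages sum_distrib_right of_nat_sum)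
qed

lemma sum_val0:
  assumes "R \<subseteq> solos \<union> units"
  shows "(\<Sum>d\<in>fillers \<union> R. val d 0) = (\<Sum>d\<in>fillers. val d 0) + sum base_val R"
proof -
  have "finite R" using assms finite_sets finite_subset by blast
  then have "(\<Sum>d\<in>fillers \<union> R. val d 0) = (\<Sum>d\<in>fillers. val d 0) + (\<Sum>d\<in>R. val d 0)"
    using assms disjoint_sets by (intro sum.union_disjoint) (auto simp: finite_sets)
  also have "(\<Sum>d\<in>R. val d 0) = sum base_val R"
    using assms disjoint_sets edges0 by (intro sum.cong refl val0) blast+
  finally show ?thesis .
qed

lemma G_size: "(\<Sum>d\<in>G. size0 d) \<le> cap"
proof -
  have "(\<Sum>d\<in>S 0. wage d 0) \<le> B' 0" by (rule wages) simp
  then show ?thesis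
    unfolding le_cap_iff using sum_wage0[OF G_subset] S0_eq by simp
qed

text \<open>\<open>Key k\<close> would leave even its home for hospital \<open>0\<close>, whereas
  \<open>Bulk k l\<close> comes only if not hired at home.\<close>

definition available :: "worker set" where
  "available = Key ` {1..N} \<union> {d \<in> units. d \<notin> S (home d)}"

lemma available_units: "available \<subseteq> units"
  by (auto simp: available_def units_def)

lemma G_optimal:
  assumes R: "R \<subseteq> solos \<union> available" and size: "(\<Sum>d\<in>R. size0 d) \<le> cap"
  shows "sum base_val R \<le> sum base_val G"
proof -
  have sub: "R \<subseteq> solos \<union> units" using R available_units by blast
  have "(\<Sum>d\<in>fillers \<union> R. val d 0) \<le> (\<Sum>d\<in>S 0. val d 0)"
  proof (rule optimal)
    show "(d, 0) \<in> edges" if "d \<in> fillers \<union> R" for d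
      using that sub edges0 by blast
    show "(\<Sum>d\<in>fillers \<union> R. wage d 0) \<le> B' 0"
      unfolding sum_wage0[OF sub] using size le_cap_iff by blast
    show "rank d h' < rank d 0" if "d \<in> fillers \<union> R" "d \<in> S h'" "h' \<noteq> 0" for d h'
    proof -
      have "(d, h') \<in> edges" by (rule S_edges) fact
      then show ?thesis
        using that R by (cases d) (auto simp: available_def fillers_def solos_def)
    qed
  qed simp
  moreover have "(\<Sum>d\<in>S 0. val d 0) = (\<Sum>d\<in>fillers. val d 0) + sum base_val G"
    using sum_val0[OF G_subset] S0_eq by simp
  ultimately show ?thesis using sum_val0[OF sub] by simp
qed

lemma size0_units: "d \<in> units \<Longrightarrow> size0 d = 1"
  by (auto simp: units_def)

lemma base_val_units: "d \<in> units \<Longrightarrow> base_val d = unit_val N d"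
  by (auto simp: units_def)

lemma unit_in_G: "d \<in> units \<Longrightarrow> d \<in> G \<longleftrightarrow> d \<in> S 0"
  using disjoint_sets by auto

text \<open>The hired \<open>Solo\<close> workers are worth at most one \<open>Solo\<close> filling
  the budget left by \<open>W\<close>, while any affordable available \<open>W'\<close> can be
  completed by such a \<open>Solo\<close>. Thus \<open>G_optimal\<close> becomes the optimality
  hypothesis of \<open>no_optimal_units\<close>.\<close>

lemma units_optimal:
  defines "W \<equiv> G \<inter> units"
  shows "card W \<le> cap"
    and "W' \<subseteq> available \<Longrightarrow> finite W' \<Longrightarrow> card W' \<le> cap \<Longrightarrow>
      sum (unit_val N) W' + triangle (cap - card W') \<le> sum (unit_val N) W + triangle (cap - card W)"
proof -
  have finG: "finite G" using G_subset finite_sets finite_subset by blast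
  define I where "I = {i. Solo i \<in> G}"
  have G: "G = Solo ` I \<union> W" "Solo ` I \<inter> W = {}"
    using G_subset by (auto simp: I_def W_def solos_def units_def)
  have fin: "finite I" "finite W"
    using finG finite_imageD[of Solo I] G(1) by (auto simp: inj_on_def)
  have split: "sum g G = (\<Sum>i\<in>I. g (Solo i)) + sum g W" for g :: "worker \<Rightarrow> 'a::comm_monoid_add"
    unfolding G(1) using fin G(2)
    by (simp add: sum.union_disjoint sum.reindex inj_on_def)
  have "(\<Sum>d\<in>W. size0 d) = card W"
    using size0_units by (simp add: W_def)
  then have size: "(\<Sum>i\<in>I. i) + card W \<le> cap"
    using G_size unfolding split by simp
  then show "card W \<le> cap" by simp
  have "(\<Sum>i\<in>I. triangle i) \<le> triangle (\<Sum>i\<in>I. i)" by (rule sum_triangle_le) fact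
  also have "\<dots> \<le> triangle (cap - card W)" using size by (intro triangle_mono) simp
  finally have upper: "sum base_val G \<le> sum (unit_val N) W + triangle (cap - card W)"
    unfolding split using base_val_units by (simp add: W_def)
  assume W': "W' \<subseteq> available" "finite W'" "card W' \<le> cap"
  \<comment> \<open>Removing 0 covers the case that \<open>W'\<close> exhausts the budget: there is
    no \<open>Solo 0\<close> in the market, and \<open>triangle 0 = 0\<close> keeps the value
    formula valid.\<close>
  define R where "R = Solo ` ({cap - card W'} - {0}) \<union> W'"
  have sub: "W' \<subseteq> units" using W'(1) available_units by blast
  have splitR: "sum g R = (\<Sum>i\<in>{cap - card W'} - {0}. g (Solo i)) + sum g W'"
    for g :: "worker \<Rightarrow> 'a::comm_monoid_add"
  proof -
    have "Solo ` ({cap - card W'} - {0}) \<inter> W' = {}"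
      using sub by (auto simp: units_def)
    then show ?thesis
      unfolding R_def using W'(2) by (simp add: sum.union_disjoint sum.reindex inj_on_def)
  qed
  have "sum base_val R \<le> sum base_val G"
  proof (rule G_optimal)
    have "{cap - card W'} - {0} \<subseteq> {1..K}" using cap_bounds(2) by auto
    then show "R \<subseteq> solos \<union> available"
      using W'(1) unfolding R_def solos_def by blast
    have "(\<Sum>d\<in>W'. size0 d) = card W'" using sub size0_units by (simp add: subset_iff)
    moreover have "(\<Sum>i\<in>{cap - card W'} - {0}. i) = cap - card W'"
      by (cases "cap - card W' = 0") auto
    ultimately show "(\<Sum>d\<in>R. size0 d) \<le> cap"
      unfolding splitR using W'(3) by simp
  qed
  moreover have "sum base_val R = triangle (cap - card W') + sum (unit_val N) W'"
  proof -
    have "sum base_val W' = sum (unit_val N) W'"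
      using sub base_val_units by (intro sum.cong) auto
    moreover have "(\<Sum>i\<in>{cap - card W'} - {0}. triangle i) = triangle (cap - card W')"
      by (cases "cap - card W' = 0") auto
    ultimately show ?thesis unfolding splitR by simp
  qed
  ultimately show "sum (unit_val N) W' + triangle (cap - card W')
      \<le> sum (unit_val N) W + triangle (cap - card W)"
    using upper by simp
qed

lemma contradiction: False
proof (rule no_optimal_units[of N cap "G \<inter> units" available])
  show "1 \<le> N" by (rule N_pos)
  show "3 * N \<le> cap" "cap \<le> N * N + 3 * N - 1"
    using cap_bounds by (auto simp: K_def)
  show "G \<inter> units \<subseteq> available"
  proof
    fix d assume d: "d \<in> G \<inter> units"
    then have "home d \<noteq> 0" by (auto simp: units_def)
    then show "d \<in> available" using unique[of d 0 "home d"] d by (auto simp: available_def)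
  qed
  show "finite (G \<inter> units)" by (simp add: finite_sets)
  show "card (G \<inter> units) \<le> cap" by (rule units_optimal)
  show "available \<subseteq> Key ` {1..N} \<union> (\<Union>k\<in>{1..N}. range (Bulk k))"
    by (auto simp: available_def units_def)
  show "Bulk k l \<notin> G \<inter> units" if "Key k \<in> G \<inter> units" for k l
    using that no_bulk_if_key by blast
  show "\<exists>L. finite L \<and> card L = 2 * N \<and> L \<subseteq> range (Bulk k) \<and> L \<subseteq> available"
    if k: "k \<in> {1..N}" and nk: "Key k \<notin> G \<inter> units" for k
  proof -
    have "Key k \<in> units" using k by (auto simp: units_def)
    then have "Key k \<notin> S 0" using nk unit_in_G by blast
    then obtain L where L: "finite L" "card L = 2 * N" "L \<subseteq> Bulk k ` {..<N * N} - S k"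
      using spare_bulk k by blast
    moreover have "Bulk k ` {..<N * N} - S k \<subseteq> available"
      using k by (force simp: available_def units_def)
    ultimately show ?thesis by blast
  qed
  show "sum (unit_val N) W' + triangle (cap - card W')
      \<le> sum (unit_val N) (G \<inter> units) + triangle (cap - card (G \<inter> units))"
    if "W' \<subseteq> available" "finite W'" "card W' \<le> cap" for W'
    using that by (rule units_optimal)
qed (auto simp: available_def)

end

theorem theorem1:
  fixes \<alpha> \<beta> :: real
  assumes "0 < \<alpha>" and "\<alpha> < \<beta>" and "\<beta> < 1"
  shows "\<exists>D H X P f B. market D H X P f B \<and>
           (\<forall>h\<in>H. max_wage X h \<le> \<beta> * B h) \<and>
           (\<forall>B'. (\<forall>h\<in>H. B h \<le> B' h \<and> B' h \<le> (1 + \<alpha>) * B h) \<longrightarrow>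
                 \<not> (\<exists>Y. stable D H X P f B' Y))"
proof -
  obtain N :: nat where N: "6 / (\<beta> - \<alpha>) \<le> real N"
    using real_arch_simple by blast
  then have "6 \<le> real N * (\<beta> - \<alpha>)"
    using assms by (simp add: pos_divide_le_eq)
  then interpret budget_window \<alpha> \<beta> N
    using assms by unfold_locales
  show ?thesis
  proof (intro exI conjI ballI allI impI)
    show "market (to_nat ` fst ` edges) {0..N} X pref utility (\<lambda>_. 1)"
      by (rule is_market)
    show "max_wage X h \<le> \<beta> * 1" for h
      using edges_bounds assms by (intro max_wage_le) auto
    fix B' :: "nat \<Rightarrow> real"
    assume B': "\<forall>h\<in>{0..N}. 1 \<le> B' h \<and> B' h \<le> (1 + \<alpha>) * 1"
    show "\<nexists>Y. stable (to_nat ` fst ` edges) {0..N} X pref utility B' Y"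
    proof
      assume "\<exists>Y. stable (to_nat ` fst ` edges) {0..N} X pref utility B' Y"
      then obtain Y where "stable (to_nat ` fst ` edges) {0..N} X pref utility B' Y" ..
      then interpret stable_outcome \<alpha> \<beta> N B' Y
        using B' by unfold_locales auto
      show False by (rule contradiction)
    qed
  qed
qed

end
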